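(* Let $\epsilon>0$. In the distributed streaming model with $k\ge 2$ sites, there is a deterministic algorithm that continuously tracks $\epsilon$-approximate $\phi$-quantiles of $A(t)$ for all $0\le\phi\le1$ simultaneously (equivalently, the coordinator maintains at every time $t$ a data structure from which, for any $x\in U$, the rank of $x$ in $A(t)$ can be extracted with additive error at most $\epsilon|A(t)|$), with total communication cost $O\!\left(\frac{k}{\epsilon}\log n\log^2\frac{1}{\epsilon}\right)$ over a sequence of $n$ items.
   Context: Distributed streaming model: a sequence $A=(a_1,\dots,a_n)$ of items from the universe $U=\{1,\dots,u\}$ arrives over time; item $a_i$ arrives at time $t_i$ ($t_1<\dots<t_n$) at exactly one of $k$ sites $S_1,\dots,S_k$. Each site has a two-way communication channel with a designated coordinator $C$ (no direct site-to-site communication). A site may initiate communication only upon the arrival of an item at it; communication is instantaneous. $A(t)$ denotes the multiset of items arrived up to time $t$. Communication cost is measured in words of $\Theta(\log n)$ bits, and $n$ is assumed sufficiently large compared with $k$ and $1/\epsilon$. A $\phi$-quantile of $A$ is an $x\in U$ such that at most $\phi|A|$ items of $A$ are smaller than $x$ and at most $(1-\phi)|A|$ are greater than $x$; an $\epsilon$-approximate $\phi$-quantile is any $\phi'$-quantile with $\phi-\epsilon\le\phi'\le\phi+\epsilon$. The rank of $x$ in $A$ is the number of items of $A$ smaller than $x$.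
   Formalization: The cost bound is stated for universes of size u ≤ n^d (d any fixed constant, so an item fits in O(1) words), and log(1/ε) is read as max(1, log(1/ε)); without these the bound fails for huge u and for ε near 1. *)

theory Defs
  imports Complex_Main "HOL-Library.Multiset"
begin

section \<open>Ranks and quantiles\<close>

definition rank :: "nat multiset \<Rightarrow> nat \<Rightarrow> nat" where
  "rank M x = size {#y \<in># M. y < x#}"

definition is_quantile :: "nat multiset \<Rightarrow> real \<Rightarrow> nat \<Rightarrow> bool" where
  "is_quantile M \<phi> x \<longleftrightarrow>
     real (size {#y \<in># M. y < x#}) \<le> \<phi> * real (size M) \<and>
     real (size {#y \<in># M. x < y#}) \<le> (1 - \<phi>) * real (size M)"

definition approx_quantile :: "real \<Rightarrow> nat multiset \<Rightarrow> real \<Rightarrow> nat \<Rightarrow> bool" where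
  "approx_quantile \<epsilon> M \<phi> x \<longleftrightarrow>
     (\<exists>\<phi>'. \<phi> - \<epsilon> \<le> \<phi>' \<and> \<phi>' \<le> \<phi> + \<epsilon> \<and> is_quantile M \<phi>' x)"

section \<open>Protocols in the distributed streaming model\<close>

text \<open>
  The sites are \<open>1, \<dots>, k\<close> and the universe is \<open>{1..u}\<close>. A message is a bit string.

  A deterministic party is modelled by functions of its local history: everything it has
  observed so far, oldest first. This loses no generality, as every state (and every message
  previously sent by that party) is determined by that history. In particular the parties see
  neither a clock nor the events at other parties.

  A site reacts to an event (the arrival of an item or a message from the coordinator) by sending
  at most one message to the coordinator, and so it is silent unless it receives an item or is
  contacted by the coordinator. The coordinator reacts to a message by sending a finite list of
  messages, each addressed to a site. Its answers to queries are functions of the messages it has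
  received.
\<close>

type_synonym message = "bool list"

datatype site_event = Item nat | Received message

type_synonym site_view = "site_event list"

type_synonym coord_view = "(nat \<times> message) list"

record protocol =
  site_send :: "nat \<Rightarrow> site_view \<Rightarrow> message option"
  coord_send :: "coord_view \<Rightarrow> (nat \<times> message) list"
  quantile_of :: "coord_view \<Rightarrow> real \<Rightarrow> nat"
  rank_of :: "coord_view \<Rightarrow> nat \<Rightarrow> real"

definition addresses_sites :: "nat \<Rightarrow> protocol \<Rightarrow> bool" where
  "addresses_sites k P \<longleftrightarrow> (\<forall>v. fst ` set (coord_send P v) \<subseteq> {1..k})"

record config =
  site_views :: "nat \<Rightarrow> site_view"
  coord_view :: coord_view
  delivered :: "message list" \<comment> \<open>all messages of both directions, for cost accounting\<close>

definition initial :: config where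
  "initial = \<lparr>site_views = (\<lambda>_. []), coord_view = [], delivered = []\<rparr>"

datatype packet = Up nat message | Down nat message

definition site_step :: "protocol \<Rightarrow> nat \<Rightarrow> site_event \<Rightarrow> config \<Rightarrow> config \<times> packet list" where
  "site_step P i e c =
     (let v = site_views c i @ [e]
      in (c\<lparr>site_views := (site_views c)(i := v)\<rparr>,
          case site_send P i v of None \<Rightarrow> [] | Some m \<Rightarrow> [Up i m]))"

definition coord_step :: "protocol \<Rightarrow> nat \<Rightarrow> message \<Rightarrow> config \<Rightarrow> config \<times> packet list" where
  "coord_step P i m c =
     (let v = coord_view c @ [(i, m)]
      in (c\<lparr>coord_view := v\<rparr>, map (\<lambda>(j, m'). Down j m') (coord_send P v)))"

fun deliver :: "protocol \<Rightarrow> packet \<Rightarrow> config \<Rightarrow> config \<times> packet list" where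
  "deliver P (Up i m) c = coord_step P i m (c\<lparr>delivered := delivered c @ [m]\<rparr>)"
| "deliver P (Down i m) c = site_step P i (Received m) (c\<lparr>delivered := delivered c @ [m]\<rparr>)"

text \<open>
  Communication is instantaneous: all messages triggered by an arrival are exchanged before the
  next item arrives. Messages in transit are delivered in the order in which they were sent.
  There is no derivation of \<open>settles\<close> if the exchange goes on forever.
\<close>

inductive settles :: "protocol \<Rightarrow> config \<times> packet list \<Rightarrow> config \<Rightarrow> bool" for P where
  quiet: "settles P (c, []) c"
| deliver: "deliver P p c = (c', qs) \<Longrightarrow> settles P (c', ps @ qs) d \<Longrightarrow> settles P (c, p # ps) d"

text \<open>
  A stream lists, in order of arrival, the pairs of receiving site and item. Only the order of the
  arrival times matters, so that the times \<open>t\<close> correspond to the prefixes of the stream.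
\<close>

type_synonym stream = "(nat \<times> nat) list"

definition is_stream :: "nat \<Rightarrow> nat \<Rightarrow> stream \<Rightarrow> bool" where
  "is_stream k u A \<longleftrightarrow> set A \<subseteq> {1..k} \<times> {1..u}"

definition items :: "stream \<Rightarrow> nat multiset" where
  "items A = mset (map snd A)"

inductive reaches :: "protocol \<Rightarrow> stream \<Rightarrow> config \<Rightarrow> bool" for P where
  start: "reaches P [] initial"
| arrival: "reaches P A c \<Longrightarrow> settles P (site_step P i (Item x) c) d \<Longrightarrow> reaches P (A @ [(i, x)]) d"

lemma settles_unique: "settles P cp d \<Longrightarrow> settles P cp d' \<Longrightarrow> d = d'"
proof (induction arbitrary: d' rule: settles.induct)
  case (quiet c)
  then show ?case by (auto elim: settles.cases)
next
  case (deliver p c c' qs ps d)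
  from deliver.prems deliver.hyps(1) have "settles P (c', ps @ qs) d'"
    by (cases rule: settles.cases) auto
  then show ?case by (rule deliver.IH)
qed

lemma reaches_unique: "reaches P A c \<Longrightarrow> reaches P A c' \<Longrightarrow> c = c'"
proof (induction arbitrary: c' rule: reaches.induct)
  case start
  then show ?case by (auto elim: reaches.cases)
next
  case (arrival A c i x d)
  from arrival.prems obtain b where "reaches P A b" "settles P (site_step P i (Item x) b) c'"
    by (cases rule: reaches.cases) auto
  with arrival.IH arrival.hyps(2) show ?case by (blast intro: settles_unique)
qed

section \<open>Correctness and cost\<close>

text \<open>
  Every prefix of a stream is itself a stream, so quantifying over all streams covers all times,
  including those before the first arrival. The length of the stream is not known to the protocol.
\<close>

definition tracks_all_quantiles :: "nat \<Rightarrow> nat \<Rightarrow> real \<Rightarrow> protocol \<Rightarrow> bool" where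
  "tracks_all_quantiles k u \<epsilon> P \<longleftrightarrow>
     (\<forall>A. is_stream k u A \<longrightarrow>
        (\<exists>c. reaches P A c \<and>
          (\<forall>\<phi>. 0 \<le> \<phi> \<and> \<phi> \<le> 1 \<longrightarrow>
             quantile_of P (coord_view c) \<phi> \<in> {1..u} \<and>
             approx_quantile \<epsilon> (items A) \<phi> (quantile_of P (coord_view c) \<phi>)) \<and>
          (\<forall>x\<in>{1..u}.
             \<bar>rank_of P (coord_view c) x - real (rank (items A) x)\<bar> \<le> \<epsilon> * real (size (items A)))))"

text \<open>
  The number of words of \<open>w\<close> bits that a message occupies. Every message costs at least one word,
  so that nothing, not even an empty message, is transmitted for free.
\<close>

definition words :: "nat \<Rightarrow> message \<Rightarrow> nat" where
  "words w m = max 1 (nat \<lceil>real (length m) / real w\<rceil>)"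

definition cost :: "nat \<Rightarrow> config \<Rightarrow> nat" where
  "cost w c = (\<Sum>m\<leftarrow>delivered c. words w m)"

end

theory Submission
  imports Defs "HOL-Library.Discrete_Functions" "HOL-Computational_Algebra.Primes"
begin

text \<open>
  No message from the coordinator is needed: if every site lets the coordinator know the ranks in
  its own stream up to the relative error \<open>\<epsilon> / 2\<close>, then the errors add up to at most \<open>\<epsilon> / 2\<close> times the
  number of all items.

  A site with \<open>t\<close> items, \<open>2 ^ r \<le> t < 2 ^ (r + 1)\<close>, reports whenever \<open>t\<close> is divisible by
  \<open>2 ^ (r - q)\<close>. If \<open>2 ^ l\<close> is the largest power of two dividing \<open>t\<close>, then it sends every \<open>2 ^ (r - p)\<close>-th
  order statistic of its last \<open>2 ^ l\<close> items. By the binary expansion of \<open>t\<close>, at most \<open>q + 1\<close> of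
  the reported blocks make up the whole prefix, each contributing an error below \<open>2 ^ (r - p)\<close>,
  and fewer than \<open>2 ^ (r - q)\<close> further items are unreported. So it suffices that \<open>2 ^ q\<close> is of the
  order \<open>1 / \<epsilon>\<close> and \<open>2 ^ p\<close> of the order \<open>(q + 1) / \<epsilon>\<close>. While \<open>t\<close> doubles, each of the \<open>q + 1\<close>
  levels \<open>l\<close> costs at most \<open>2 ^ p\<close> items, which yields \<open>(1 / \<epsilon>) log\<^sup>2 (1 / \<epsilon>)\<close> words per site and
  doubling.

  The coordinator does not reconstruct anything from the messages: it picks any stream that is
  consistent with what it received and answers exactly for that one. Hence it is enough to show that
  two streams with the same messages have almost the same ranks.
\<close>

section \<open>One-way protocols\<close>

definition items_at :: "nat \<Rightarrow> stream \<Rightarrow> nat list" where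
  "items_at i A = map snd (filter (\<lambda>a. fst a = i) A)"

lemma items_at_snoc: "items_at i (A @ [(j, x)]) = (if i = j then items_at i A @ [x] else items_at i A)"
  by (simp add: items_at_def)

fun item_of :: "site_event \<Rightarrow> nat option" where
  "item_of (Item x) = Some x"
| "item_of (Received m) = None"

definition one_way ::
  "(nat list \<Rightarrow> message option) \<Rightarrow> (coord_view \<Rightarrow> real \<Rightarrow> nat) \<Rightarrow> (coord_view \<Rightarrow> nat \<Rightarrow> real) \<Rightarrow> protocol" where
  "one_way f q r = \<lparr>site_send = (\<lambda>i v. f (List.map_filter item_of v)), coord_send = (\<lambda>_. []),
     quantile_of = q, rank_of = r\<rparr>"

text \<open>Closed form of the coordinator's view, read off the stream without running the protocol;
  \<open>one_way_reaches\<close> justifies it.\<close>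

definition transcript :: "(nat list \<Rightarrow> message option) \<Rightarrow> stream \<Rightarrow> coord_view" where
  "transcript f A =
     List.map_filter (\<lambda>t. let i = fst (A ! t) in map_option (Pair i) (f (items_at i (take (Suc t) A))))
       [0..<length A]"

definition sent :: "(nat list \<Rightarrow> message option) \<Rightarrow> nat list \<Rightarrow> message list" where
  "sent f xs = List.map_filter (\<lambda>t. f (take t xs)) [1..<Suc (length xs)]"

lemma map_filter_append:
  "List.map_filter f (xs @ ys) = List.map_filter f xs @ List.map_filter f ys"
  by (simp add: List.map_filter_def)

lemma map_filter_cong:
  "(\<And>x. x \<in> set xs \<Longrightarrow> f x = g x) \<Longrightarrow> List.map_filter f xs = List.map_filter g xs"
  by (induction xs) (auto split: option.splits)

lemma map_filter_item_of [simp]: "List.map_filter item_of (map Item xs) = xs"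
  by (induction xs) auto

lemma transcript_Nil [simp]: "transcript f [] = []"
  by (simp add: transcript_def)

lemma transcript_snoc:
  "transcript f (A @ [(i, x)]) =
     transcript f A @ (case f (items_at i A @ [x]) of None \<Rightarrow> [] | Some m \<Rightarrow> [(i, m)])"
proof -
  let ?g = "\<lambda>A t. let i = fst (A ! t) in map_option (Pair i) (f (items_at i (take (Suc t) A)))"
  have "List.map_filter (?g (A @ [(i, x)])) [0..<length A] = List.map_filter (?g A) [0..<length A]"
    by (rule map_filter_cong) (auto simp: nth_append)
  then show ?thesis
    by (simp add: transcript_def map_filter_append Let_def items_at_snoc split: option.split)
qed

lemma sent_Nil [simp]: "sent f [] = []"
  by (simp add: sent_def)

lemma sent_snoc:
  "sent f (xs @ [x]) = sent f xs @ (case f (xs @ [x]) of None \<Rightarrow> [] | Some m \<Rightarrow> [m])"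
proof -
  have "List.map_filter (\<lambda>t. f (take t (xs @ [x]))) [1..<Suc (length xs)] = sent f xs"
    unfolding sent_def by (rule map_filter_cong) auto
  then show ?thesis
    by (simp add: sent_def map_filter_append split: option.split)
qed

text \<open>Turns equality of coordinator views into equality of the message sequences of every
  single site.\<close>

lemma transcript_at_site: "map snd (filter (\<lambda>a. fst a = i) (transcript f A)) = sent f (items_at i A)"
proof (induction A rule: rev_induct)
  case (snoc a A)
  then show ?case
    by (cases a) (auto simp: transcript_snoc items_at_snoc sent_snoc split: option.splits)
qed (simp add: items_at_def)

text \<open>The coordinator never answers, so each arrival settles after at most one delivery, and
  site views consist of \<open>Item\<close> events only.\<close>

lemma one_way_reaches:
  "reaches (one_way f q r) A
     \<lparr>site_views = (\<lambda>i. map Item (items_at i A)), coord_view = transcript f A,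
      delivered = map snd (transcript f A)\<rparr>"
proof (induction A rule: rev_induct)
  case Nil
  have "initial = \<lparr>site_views = (\<lambda>i. map Item (items_at i [])), coord_view = transcript f [],
      delivered = map snd (transcript f [])\<rparr>"
    by (simp add: initial_def items_at_def)
  then show ?case by (metis reaches.start)
next
  case (snoc a A)
  obtain i x where a: "a = (i, x)" by (cases a)
  let ?c = "\<lambda>A. \<lparr>site_views = (\<lambda>i. map Item (items_at i A)), coord_view = transcript f A,
      delivered = map snd (transcript f A)\<rparr>"
  have views: "(\<lambda>j. map Item (items_at j A))(i := map Item (items_at i A) @ [Item x]) =
      (\<lambda>j. map Item (items_at j (A @ [(i, x)])))"
    by (auto simp: items_at_snoc)
  have view: "List.map_filter item_of (map Item (items_at i A) @ [Item x]) = items_at i A @ [x]"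
    by (simp add: map_filter_append)
  have "settles (one_way f q r) (site_step (one_way f q r) i (Item x) (?c A)) (?c (A @ [(i, x)]))"
    by (cases "f (items_at i A @ [x])")
      (auto simp: site_step_def coord_step_def one_way_def view views transcript_snoc
        intro!: settles.intros)
  with snoc show ?case unfolding a by (rule reaches.arrival)
qed

text \<open>By \<open>reaches_unique\<close>, \<open>c\<close> is the configuration from
  \<open>one_way_reaches\<close>. Each arrival adds at most one message, charged to the receiving
  site, so the sites can be analysed separately.\<close>

lemma cost_one_way:
  assumes "is_stream k u A" "reaches (one_way f q r) A c"
  shows "cost w c = (\<Sum>i=1..k. \<Sum>m\<leftarrow>sent f (items_at i A). words w m)"
proof -
  have "(\<Sum>m\<leftarrow>map snd (transcript f A). words w m) =
      (\<Sum>i=1..k. \<Sum>m\<leftarrow>sent f (items_at i A). words w m)"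
    using assms(1)
  proof (induction A rule: rev_induct)
    case (snoc a A)
    obtain i x where a: "a = (i, x)" by (cases a)
    define g where "g = (case f (items_at i A @ [x]) of None \<Rightarrow> 0 | Some m \<Rightarrow> words w m)"
    have i: "i \<in> {1..k}" and A: "is_stream k u A"
      using snoc.prems by (auto simp: a is_stream_def)
    have "(\<Sum>m\<leftarrow>sent f (items_at j (A @ [a])). words w m) =
        (\<Sum>m\<leftarrow>sent f (items_at j A). words w m) + (if j = i then g else 0)" for j
      by (auto simp: a items_at_snoc sent_snoc g_def split: option.split)
    then have "(\<Sum>j=1..k. \<Sum>m\<leftarrow>sent f (items_at j (A @ [a])). words w m) =
        (\<Sum>j=1..k. \<Sum>m\<leftarrow>sent f (items_at j A). words w m) + g"
      using i by (simp add: sum.distrib)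
    also have "\<dots> = (\<Sum>m\<leftarrow>map snd (transcript f (A @ [a])). words w m)"
      using snoc.IH[OF A] by (simp add: a transcript_snoc g_def split: option.split)
    finally show ?case by simp
  qed (simp add: items_at_def)
  then show ?thesis
    using reaches_unique[OF one_way_reaches assms(2)] by (auto simp: cost_def)
qed

section \<open>Decoding by indistinguishability\<close>

lemma rank_union: "rank (M + N) x = rank M x + rank N x"
  by (simp add: rank_def)

lemma rank_le_size: "rank M x \<le> size M"
  by (simp add: rank_def size_filter_mset_lesseq)

lemma rank_mono: "x \<le> y \<Longrightarrow> rank M x \<le> rank M y"
  unfolding rank_def by (intro size_mset_mono filter_mset_mono_strong) auto

lemma size_greater: "size {#y \<in># M. x < y#} = size M - rank M (Suc x)"
proof -
  have "size M = size {#y \<in># M. y < Suc x#} + size {#y \<in># M. \<not> y < Suc x#}"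
    by (metis multiset_partition size_union)
  moreover have "{#y \<in># M. \<not> y < Suc x#} = {#y \<in># M. x < y#}"
    by (rule filter_mset_cong) auto
  ultimately show ?thesis by (simp add: rank_def)
qed

text \<open>An item is greater than \<open>x\<close> iff it is not below \<open>Suc x\<close>. So
  \<open>\<phi> * size M\<close> has to lie between two consecutive ranks, a form in which rank
  errors carry over easily.\<close>

lemma is_quantile_iff:
  "is_quantile M \<phi> x \<longleftrightarrow>
     real (rank M x) \<le> \<phi> * real (size M) \<and> \<phi> * real (size M) \<le> real (rank M (Suc x))"
  using rank_le_size[of M "Suc x"] unfolding is_quantile_def size_greater
  by (auto simp: rank_def[symmetric] of_nat_diff algebra_simps)

text \<open>The largest \<open>x\<close> with \<open>rank M x \<le> \<phi> * size M\<close> works: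
  \<open>Suc x\<close> violates the condition, unless \<open>x = u\<close>, where
  \<open>rank M (Suc u) = size M\<close>.\<close>

lemma quantile_exists:
  assumes "u \<ge> 1" "set_mset M \<subseteq> {1..u}" "0 \<le> \<phi>" "\<phi> \<le> 1"
  shows "\<exists>x\<in>{1..u}. is_quantile M \<phi> x"
proof -
  let ?S = "{x \<in> {1..u}. real (rank M x) \<le> \<phi> * real (size M)}"
  have "rank M 1 = 0"
    using assms(2) by (force simp: rank_def)
  then have "1 \<in> ?S" using assms by simp
  then have S: "finite ?S" "?S \<noteq> {}" by auto
  define x where "x = Max ?S"
  have x: "x \<in> ?S" unfolding x_def using S by (rule Max_in)
  have "\<phi> * real (size M) \<le> real (rank M (Suc x))"
  proof (cases "x = u")
    case True
    have "{#y \<in># M. y < Suc u#} = M"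
      using assms(2) by (intro filter_mset_eq_conv[THEN iffD2]) auto
    then have "rank M (Suc x) = size M" using True by (simp add: rank_def)
    then show ?thesis using assms(4) by (simp add: mult_left_le_one_le assms(3))
  next
    case False
    have "Suc x \<notin> ?S" using Max_ge[OF S(1), of "Suc x"] unfolding x_def[symmetric] by auto
    then show ?thesis using x False by auto
  qed
  then show ?thesis using x by (auto simp: is_quantile_iff)
qed

text \<open>Two errors of \<open>\<epsilon> / 2\<close> add up, one from the ranks and one from
  replacing \<open>size M'\<close> by \<open>size M\<close> in
  \<open>\<phi> * size M'\<close>.\<close>

lemma approx_quantile_transfer:
  assumes "is_quantile M' \<phi> x" "0 \<le> \<phi>" "\<phi> \<le> 1" "0 \<le> \<epsilon>"
    and rank: "\<And>x. \<bar>real (rank M' x) - real (rank M x)\<bar> \<le> \<epsilon> / 2 * real (size M)"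
    and size: "\<bar>real (size M') - real (size M)\<bar> \<le> \<epsilon> / 2 * real (size M)"
  shows "approx_quantile \<epsilon> M \<phi> x"
proof (cases "size M = 0")
  case True
  then have "M = {#}" by simp
  then have "is_quantile M \<phi> x" by (simp add: is_quantile_def)
  then show ?thesis using assms(4) by (auto simp: approx_quantile_def intro!: exI[of _ \<phi>])
next
  case False
  define n where "n = real (size M)"
  have n: "n > 0" using False unfolding n_def by linarith
  have "\<bar>\<phi> * (real (size M') - n)\<bar> \<le> \<epsilon> / 2 * n"
    using size mult_right_mono[OF assms(3) abs_ge_zero, of "real (size M') - n"] assms(2)
    by (simp add: abs_mult n_def)
  then have *: "\<bar>\<phi> * real (size M') - \<phi> * n\<bar> \<le> \<epsilon> / 2 * n"
    by (simp add: algebra_simps)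
  have q: "real (rank M' x) \<le> \<phi> * real (size M')" "\<phi> * real (size M') \<le> real (rank M' (Suc x))"
    using assms(1) by (auto simp: is_quantile_iff)
  have lo: "real (rank M x) \<le> (\<phi> + \<epsilon>) * n" and hi: "(\<phi> - \<epsilon>) * n \<le> real (rank M (Suc x))"
    using q * rank[of x] rank[of "Suc x"] unfolding n_def[symmetric] distrib_right left_diff_distrib
    by linarith+
  \<comment> \<open>The larger of the left ends of
    \<open>[\<phi> - \<epsilon>, \<phi> + \<epsilon>]\<close> and
    \<open>[rank M x / n, rank M (Suc x) / n]\<close>. By \<open>lo\<close> and \<open>hi\<close>
    these intervals meet, so it lies in both.\<close>
  define \<phi>' where "\<phi>' = max (\<phi> - \<epsilon>) (real (rank M x) / n)"
  have m: "real (rank M x) \<le> real (rank M (Suc x))" by (simp add: rank_mono)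
  have "\<phi>' \<le> \<phi> + \<epsilon>" using lo n assms(4) by (simp add: \<phi>'_def divide_le_eq)
  moreover have "real (rank M x) \<le> \<phi>' * n"
    using n by (simp add: \<phi>'_def flip: pos_divide_le_eq)
  moreover have "\<phi>' * n \<le> real (rank M (Suc x))"
    using n hi m unfolding pos_le_divide_eq[OF n, symmetric] by (simp add: \<phi>'_def divide_right_mono)
  ultimately show ?thesis
    unfolding approx_quantile_def is_quantile_iff n_def[symmetric]
    by (intro exI[of _ \<phi>']) (simp add: \<phi>'_def)
qed

section \<open>Splitting a stream by sites, and the decoder\<close>

lemma items_decompose:
  assumes "is_stream k u A"
  shows "rank (items A) x = (\<Sum>i=1..k. rank (mset (items_at i A)) x)"
    and "length A = (\<Sum>i=1..k. length (items_at i A))"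
proof -
  have "items A = (\<Sum>i=1..k. mset (items_at i A))"
    using assms
  proof (induction A rule: rev_induct)
    case (snoc a A)
    obtain i x where a: "a = (i, x)" by (cases a)
    have i: "i \<in> {1..k}" and A: "is_stream k u A"
      using snoc.prems by (auto simp: a is_stream_def)
    have "mset (items_at j (A @ [a])) = mset (items_at j A) + (if j = i then {#x#} else {#})" for j
      by (auto simp: a items_at_snoc)
    then show ?case using i snoc.IH[OF A] by (simp add: sum.distrib a items_def)
  qed (simp add: items_def items_at_def)
  moreover have "rank (\<Sum>i\<in>I. F i) x = (\<Sum>i\<in>I. rank (F i) x)" for I :: "nat set" and F
    by (induction I rule: infinite_finite_induct) (simp_all add: rank_union, simp_all add: rank_def)
  moreover have "size (\<Sum>i\<in>I. F i) = (\<Sum>i\<in>I. size (F i))" for I :: "nat set" and F :: "nat \<Rightarrow> nat multiset"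
    by (induction I rule: infinite_finite_induct) auto
  moreover have "length A = size (items A)" by (simp add: items_def)
  ultimately show "rank (items A) x = (\<Sum>i=1..k. rank (mset (items_at i A)) x)"
    and "length A = (\<Sum>i=1..k. length (items_at i A))"
    by simp_all
qed

definition consistent_items :: "nat \<Rightarrow> nat \<Rightarrow> (nat list \<Rightarrow> message option) \<Rightarrow> coord_view \<Rightarrow> nat multiset" where
  "consistent_items k u f v = items (SOME A. is_stream k u A \<and> transcript f A = v)"

definition decoding_protocol :: "nat \<Rightarrow> nat \<Rightarrow> (nat list \<Rightarrow> message option) \<Rightarrow> protocol" where
  "decoding_protocol k u f = one_way f
     (\<lambda>v \<phi>. SOME x. x \<in> {1..u} \<and> is_quantile (consistent_items k u f v) \<phi> x)
     (\<lambda>v x. real (rank (consistent_items k u f v) x))"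

text \<open>In \<open>indist\<close>, \<open>xs\<close> stands for the true items of a site and
  \<open>ys\<close> for the guessed ones, hence the error relative to \<open>length xs\<close>.
  Summed over the sites, these lengths give the size of the true stream.\<close>

lemma tracks_decoding_protocol:
  assumes u: "u \<ge> 1" and e: "\<epsilon> > 0"
    and indist: "\<And>xs ys x. set xs \<subseteq> {1..u} \<Longrightarrow> set ys \<subseteq> {1..u} \<Longrightarrow> sent f xs = sent f ys \<Longrightarrow>
      \<bar>real (rank (mset ys) x) - real (rank (mset xs) x)\<bar> \<le> \<epsilon> / 2 * real (length xs)"
  shows "tracks_all_quantiles k u \<epsilon> (decoding_protocol k u f)"
  unfolding tracks_all_quantiles_def
proof (intro allI impI)
  fix A assume A: "is_stream k u A"
  define M where "M = consistent_items k u f (transcript f A)"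
  define B where "B = (SOME B. is_stream k u B \<and> transcript f B = transcript f A)"
  have B: "is_stream k u B" "transcript f B = transcript f A"
    using someI[of "\<lambda>B. is_stream k u B \<and> transcript f B = transcript f A" A] A
    unfolding B_def by auto
  have M: "M = items B" by (simp add: M_def consistent_items_def B_def)
  have rank: "\<bar>real (rank M x) - real (rank (items A) x)\<bar> \<le> \<epsilon> / 2 * real (size (items A))" for x
  proof -
    have *: "\<bar>real (rank (mset (items_at i B)) x) - real (rank (mset (items_at i A)) x)\<bar>
        \<le> \<epsilon> / 2 * real (length (items_at i A))" for i
      using A B(1) transcript_at_site[of i f A] transcript_at_site[of i f B] B(2)
      by (intro indist) (auto simp: items_at_def is_stream_def)
    have "\<bar>real (rank M x) - real (rank (items A) x)\<bar> =
        \<bar>\<Sum>i=1..k. real (rank (mset (items_at i B)) x) - real (rank (mset (items_at i A)) x)\<bar>"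
      by (simp add: M items_decompose(1)[OF A] items_decompose(1)[OF B(1)] sum_subtractf)
    also have "\<dots> \<le> (\<Sum>i=1..k. \<epsilon> / 2 * real (length (items_at i A)))"
      by (rule order_trans[OF sum_abs]) (rule sum_mono[OF *])
    also have "\<dots> = \<epsilon> / 2 * real (length A)"
      by (simp add: items_decompose(2)[OF A] sum_distrib_left)
    finally show ?thesis by (simp add: items_def)
  qed
  have in_u: "set_mset (items A) \<subseteq> {1..u}" "set_mset M \<subseteq> {1..u}"
    using A B(1) by (auto simp: M items_def is_stream_def)
  \<comment> \<open>At \<open>Suc u\<close> the rank counts all items, so the rank bound contains
    the size bound.\<close>
  then have "rank (items A) (Suc u) = size (items A)" "rank M (Suc u) = size M"
    unfolding rank_def by (auto intro!: arg_cong[of _ _ size] filter_mset_eq_conv[THEN iffD2])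
  with rank[of "Suc u"]
  have size: "\<bar>real (size M) - real (size (items A))\<bar> \<le> \<epsilon> / 2 * real (size (items A))"
    by simp
  let ?c = "\<lparr>site_views = (\<lambda>i. map Item (items_at i A)), coord_view = transcript f A,
      delivered = map snd (transcript f A)\<rparr>"
  let ?P = "decoding_protocol k u f"
  have q: "quantile_of ?P (coord_view ?c) \<phi> \<in> {1..u}"
    "approx_quantile \<epsilon> (items A) \<phi> (quantile_of ?P (coord_view ?c) \<phi>)"
    if "0 \<le> \<phi>" "\<phi> \<le> 1" for \<phi>
  proof -
    let ?x = "quantile_of ?P (coord_view ?c) \<phi>"
    have x: "?x \<in> {1..u} \<and> is_quantile M \<phi> ?x"
      using someI_ex[of "\<lambda>x. x \<in> {1..u} \<and> is_quantile M \<phi> x"] quantile_exists[OF u in_u(2) that]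
      unfolding decoding_protocol_def one_way_def M_def by (simp add: Bex_def)
    then show "?x \<in> {1..u}" by blast
    show "approx_quantile \<epsilon> (items A) \<phi> ?x"
      using x that rank size e by (intro approx_quantile_transfer[of M]) auto
  qed
  have r: "\<bar>rank_of ?P (coord_view ?c) x - real (rank (items A) x)\<bar> \<le> \<epsilon> * real (size (items A))" for x
  proof -
    have "\<epsilon> / 2 * real (size (items A)) \<le> \<epsilon> * real (size (items A))"
      using e by (intro mult_right_mono) auto
    then show ?thesis
      using rank[of x] by (simp add: decoding_protocol_def one_way_def M_def)
  qed
  show "\<exists>c. reaches ?P A c \<and>
          (\<forall>\<phi>. 0 \<le> \<phi> \<and> \<phi> \<le> 1 \<longrightarrow>
             quantile_of ?P (coord_view c) \<phi> \<in> {1..u} \<and>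
             approx_quantile \<epsilon> (items A) \<phi> (quantile_of ?P (coord_view c) \<phi>)) \<and>
          (\<forall>x\<in>{1..u}. \<bar>rank_of ?P (coord_view c) x - real (rank (items A) x)\<bar> \<le> \<epsilon> * real (size (items A)))"
    using q r one_way_reaches unfolding decoding_protocol_def by (intro exI[of _ ?c]) blast
qed

text \<open>Every \<open>x\<close> is a \<open>\<phi>'\<close>-quantile for some
  \<open>\<phi>'\<close> in \<open>[0, 1]\<close>, which differs from \<open>\<phi>\<close> by at
  most 1. So for \<open>\<epsilon> \<ge> 1\<close> constant answers suffice.\<close>

lemma tracks_silent:
  assumes "u \<ge> 1" "\<epsilon> \<ge> 1"
  shows "tracks_all_quantiles k u \<epsilon> (one_way (\<lambda>_. None) (\<lambda>_ _. 1) (\<lambda>_ _. 0))"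
  unfolding tracks_all_quantiles_def
proof (intro allI impI)
  fix A
  let ?c = "\<lparr>site_views = (\<lambda>i. map Item (items_at i A)), coord_view = transcript (\<lambda>_. None) A,
      delivered = map snd (transcript (\<lambda>_. None) A)\<rparr>"
  let ?P = "one_way (\<lambda>_. None) (\<lambda>_ _. 1) (\<lambda>_ _. 0)"
  have "approx_quantile \<epsilon> M \<phi> x" if "0 \<le> \<phi>" "\<phi> \<le> 1" for M \<phi> x
  proof -
    \<comment> \<open>For empty \<open>M\<close> the quotient is 0 by convention, which serves as
      well.\<close>
    define \<phi>' where "\<phi>' = real (rank M x) / real (size M)"
    have "0 \<le> \<phi>'" "\<phi>' \<le> 1"
      using rank_le_size[of M x] by (auto simp: \<phi>'_def divide_le_eq_1 simp flip: nonempty_has_size)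
    moreover have "\<phi>' * real (size M) = real (rank M x)"
      using rank_le_size[of M x] by (cases "size M = 0") (auto simp: \<phi>'_def)
    then have "is_quantile M \<phi>' x" by (simp add: is_quantile_iff rank_mono)
    ultimately show ?thesis
      using that assms(2) unfolding approx_quantile_def by (intro exI[of _ \<phi>']) auto
  qed
  moreover have "real (rank M x) \<le> \<epsilon> * real (size M)" for M x
    using mult_mono[of 1 \<epsilon> "real (rank M x)" "real (size M)"] assms(2) rank_le_size[of M x] by simp
  ultimately show "\<exists>c. reaches ?P A c \<and>
          (\<forall>\<phi>. 0 \<le> \<phi> \<and> \<phi> \<le> 1 \<longrightarrow>
             quantile_of ?P (coord_view c) \<phi> \<in> {1..u} \<and>
             approx_quantile \<epsilon> (items A) \<phi> (quantile_of ?P (coord_view c) \<phi>)) \<and>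
          (\<forall>x\<in>{1..u}. \<bar>rank_of ?P (coord_view c) x - real (rank (items A) x)\<bar> \<le> \<epsilon> * real (size (items A)))"
    using assms(1) one_way_reaches[of "\<lambda>_. None" "\<lambda>_ _. 1" "\<lambda>_ _. 0" A]
    by (intro exI[of _ ?c]) (auto simp: one_way_def)
qed

section \<open>Summaries\<close>

text \<open>In a sorted list the entries below \<open>x\<close> form a prefix, whose length is the
  rank of \<open>x\<close>.\<close>

lemma sorted_nth_less_iff:
  assumes "sorted zs" "i < length zs"
  shows "zs ! i < x \<longleftrightarrow> i < rank (mset zs) x"
  using assms
proof (induction zs arbitrary: i)
  case (Cons z zs)
  have rank: "rank (mset (z # zs)) x = (if z < x then Suc (rank (mset zs) x) else rank (mset zs) x)"
    by (simp add: rank_def)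
  show ?case
  proof (cases "z < x")
    case True
    then show ?thesis using Cons.IH Cons.prems rank by (cases i) simp_all
  next
    case False
    then have "\<forall>y\<in>set (z # zs). \<not> y < x" using Cons.prems(1) by auto
    moreover from this have "rank (mset (z # zs)) x = 0"
      by (auto simp: rank_def)
    moreover have "(z # zs) ! i \<in> set (z # zs)" using Cons.prems(2) by (rule nth_mem)
    ultimately show ?thesis by (metis not_less0)
  qed
qed simp

definition summary :: "nat \<Rightarrow> nat list \<Rightarrow> nat list" where
  "summary s ys = map (\<lambda>i. sort ys ! (i * s + (s - 1))) [0..<length ys div s]"

text \<open>If the rank in \<open>zs\<close> exceeded that in \<open>ys\<close> by \<open>s\<close>
  or more, some sampled position would lie in between, and the entry there would be below
  \<open>x\<close> in \<open>zs\<close> but not in \<open>ys\<close>.\<close>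

lemma rank_le_of_summary_eq:
  assumes "s > 0" "length ys = length zs" "summary s ys = summary s zs"
  shows "rank (mset zs) x \<le> rank (mset ys) x + (s - 1)"
proof (rule ccontr)
  define a where "a = rank (mset ys) x"
  define i where "i = a div s"
  \<comment> \<open>The first sampled position that is at least \<open>a\<close>.\<close>
  define j where "j = i * s + (s - 1)"
  assume "\<not> ?thesis"
  then have lt: "a + (s - 1) < rank (mset zs) x" by (simp add: a_def)
  have "a = i * s + a mod s" "a mod s < s" using assms(1) by (simp_all add: i_def)
  then have j: "a \<le> j" "j \<le> a + (s - 1)" unfolding j_def by linarith+
  have len: "rank (mset zs) x \<le> length zs" using rank_le_size[of "mset zs"] by simp
  then have jl: "j < length zs" using lt j by linarith
  have "(i + 1) * s \<le> length zs"
    using jl assms(1) unfolding j_def by (simp add: algebra_simps)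
  then have "i < length zs div s"
    using less_eq_div_iff_mult_less_eq[OF assms(1), of "i + 1" "length zs"] by simp
  then have "summary s ys ! i = sort ys ! j" "summary s zs ! i = sort zs ! j"
    using assms(2) by (simp_all add: summary_def j_def)
  then have eq: "sort ys ! j = sort zs ! j" using assms(3) by simp
  have "\<not> sort ys ! j < x"
    using sorted_nth_less_iff[of "sort ys" j x] jl assms(2) j by (simp add: a_def)
  moreover have "sort zs ! j < x"
    using sorted_nth_less_iff[of "sort zs" j x] jl j lt by simp
  ultimately show False using eq by simp
qed

section \<open>Fixed-width encoding of items\<close>

definition encode :: "nat \<Rightarrow> nat \<Rightarrow> message" where
  "encode b x = map (bit x) [0..<b]"

lemma encode_inj:
  assumes "x < 2 ^ b" "y < 2 ^ b" "encode b x = encode b y"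
  shows "x = y"
proof -
  have "take_bit b x = take_bit b y"
    using arg_cong[OF assms(3), of "horner_sum of_bool (2 :: nat)"]
    by (simp only: encode_def horner_sum_bit_eq_take_bit)
  then show ?thesis using assms(1,2) by (simp only: take_bit_nat_eq_self_iff[THEN iffD2])
qed

text \<open>All code words have length \<open>b\<close>, so the concatenation can be cut without
  separators. Equal list lengths are demanded because code words are empty for
  \<open>b = 0\<close>.\<close>

lemma concat_encode_inj:
  assumes "concat (map (encode b) xs) = concat (map (encode b) ys)" "length xs = length ys"
    "set xs \<subseteq> {..<2 ^ b}" "set ys \<subseteq> {..<2 ^ b}"
  shows "xs = ys"
proof -
  have "map (encode b) xs = map (encode b) ys"
    using assms(1,2)
    by (intro concat_injective) (auto simp: encode_def set_zip)
  moreover have "inj_on (encode b) (set xs \<union> set ys)"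
  proof (rule inj_onI)
    fix x y assume "x \<in> set xs \<union> set ys" "y \<in> set xs \<union> set ys" "encode b x = encode b y"
    moreover from this have "x < 2 ^ b" "y < 2 ^ b" using assms(3,4) by auto
    ultimately show "x = y" by (blast intro: encode_inj)
  qed
  ultimately show ?thesis by (rule map_inj_on)
qed

text \<open>The last \<^term>\<open>block t\<close> items before time \<^term>\<open>t\<close> form a dyadic block, and the blocks reported
  at \<^term>\<open>t\<close>, \<^term>\<open>t - block t\<close>, and so on, follow the binary expansion of \<^term>\<open>t\<close>.\<close>

definition block :: "nat \<Rightarrow> nat" where
  "block t = 2 ^ multiplicity 2 t"

text \<open>For \<open>floor_log t \<le> p\<close> the subtraction yields \<open>0\<close>, so that the whole block is sent.\<close>

definition spacing :: "nat \<Rightarrow> nat \<Rightarrow> nat" where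
  "spacing p t = 2 ^ (floor_log t - p)"

text \<open>By truncated subtraction, every positive time below \<open>2 ^ Suc q\<close> is a
  reporting time.\<close>

definition reports_at :: "nat \<Rightarrow> nat \<Rightarrow> bool" where
  "reports_at q t \<longleftrightarrow> t > 0 \<and> 2 ^ (floor_log t - q) dvd t"

definition block_summary :: "nat \<Rightarrow> nat list \<Rightarrow> nat list" where
  "block_summary p xs = summary (spacing p (length xs)) (drop (length xs - block (length xs)) xs)"

definition report :: "nat \<Rightarrow> nat \<Rightarrow> nat \<Rightarrow> nat list \<Rightarrow> message option" where
  "report q p b xs =
     (if reports_at q (length xs) then Some (concat (map (encode b) (block_summary p xs))) else None)"

section \<open>What the messages reveal about the reports\<close>

lemma sent_report:
  "sent (report q p b) xs =
     map (\<lambda>t. concat (map (encode b) (block_summary p (take t xs))))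
       (filter (reports_at q) [1..<Suc (length xs)])"
proof -
  have "sent (report q p b) xs = List.map_filter (\<lambda>t. if reports_at q t
      then Some (concat (map (encode b) (block_summary p (take t xs)))) else None) [1..<Suc (length xs)]"
    unfolding sent_def by (rule map_filter_cong) (auto simp: report_def)
  then show ?thesis by (simp add: List.map_filter_map_filter)
qed

lemma set_summary: "s > 0 \<Longrightarrow> set (summary s ys) \<subseteq> set ys"
proof
  fix y assume s: "s > 0" and "y \<in> set (summary s ys)"
  then obtain i where i: "i < length ys div s" "y = sort ys ! (i * s + (s - 1))"
    by (auto simp: summary_def)
  have "Suc i * s \<le> length ys"
    using i(1) less_eq_div_iff_mult_less_eq[OF s, of "Suc i" "length ys"] by simp
  then have "i * s + (s - 1) < length (sort ys)" using s by simp
  then show "y \<in> set ys" using i(2) nth_mem set_sort by metis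
qed

lemma block_dvd: "block t dvd t"
  by (simp add: block_def multiplicity_dvd)

text \<open>Reporting times depend on the number of items only, so those up to \<open>m\<close> form
  a prefix of those up to \<open>n\<close> for \<open>m \<le> n\<close>. Hence the number of
  messages fixes the reporting times, and these fix the lengths needed for decoding.\<close>

lemma sent_report_eqD:
  assumes eq: "sent (report q p b) xs = sent (report q p b) ys"
    and bits: "set xs \<subseteq> {..<2 ^ b}" "set ys \<subseteq> {..<2 ^ b}"
  shows "t \<le> length xs \<and> reports_at q t \<longleftrightarrow> t \<le> length ys \<and> reports_at q t" (is ?A)
    and "t \<le> length xs \<Longrightarrow> reports_at q t \<Longrightarrow>
      block_summary p (take t xs) = block_summary p (take t ys)"
proof -
  let ?T = "\<lambda>n. filter (reports_at q) [1..<Suc n]"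
  have T: "?T m = ?T n" if "length (?T m) = length (?T n)" "m \<le> n" for m n
  proof -
    have "[1..<Suc n] = [1..<Suc m] @ [Suc m..<Suc n]"
      using that(2) upt_add_eq_append[of 1 "Suc m" "n - m"] by simp
    then show ?thesis using that(1) by simp
  qed
  have "length (?T (length xs)) = length (?T (length ys))"
    using arg_cong[OF eq, of length] by (simp only: sent_report length_map)
  then have TT: "?T (length xs) = ?T (length ys)"
    using T[of "length xs" "length ys"] T[of "length ys" "length xs"]
    by (metis nat_le_linear)
  have set_T: "set (?T n) = {t. t \<le> n \<and> reports_at q t}" for n
    by (auto simp: reports_at_def)
  show A: ?A using arg_cong[OF TT, of set] unfolding set_T by blast
  assume t: "t \<le> length xs" "reports_at q t"
  then have ty: "t \<le> length ys" using A by blast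
  have "t \<in> set (?T (length ys))" using ty t(2) unfolding set_T by blast
  then have enc: "concat (map (encode b) (block_summary p (take t xs))) =
      concat (map (encode b) (block_summary p (take t ys)))"
    using eq unfolding sent_report TT map_eq_conv by blast
  have sub: "set (block_summary p (take t zs)) \<subseteq> set zs" for zs
    unfolding block_summary_def
    by (rule order_trans[OF set_summary order_trans[OF set_drop_subset set_take_subset]])
      (simp add: spacing_def)
  show "block_summary p (take t xs) = block_summary p (take t ys)"
    using enc sub[of xs] sub[of ys] bits t(1) ty
    by (intro concat_encode_inj) (auto simp: block_summary_def summary_def)
qed

text \<open>The cofactor of \<open>2 ^ l\<close> is odd and becomes even when decreased by one: the
  lowest set bit of \<open>t\<close> is cleared.\<close>

lemma odd_multiple:
  assumes "2 ^ l dvd t" "\<not> 2 ^ Suc l dvd (t::nat)"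
  shows "2 ^ Suc l dvd t - 2 ^ l" "2 ^ l \<le> t"
proof -
  obtain m where m: "t = 2 ^ l * m" using assms(1) by auto
  then have "odd m" using assms(2) by auto
  then show "2 ^ l \<le> t" by (auto simp: m elim!: oddE)
  have "t - 2 ^ l = 2 ^ l * (m - 1)" by (simp add: m diff_mult_distrib2)
  moreover have "even (m - 1)" using \<open>odd m\<close> by simp
  ultimately show "2 ^ Suc l dvd t - 2 ^ l" by (simp add: mult_dvd_mono mult.commute)
qed

text \<open>Removing the last block removes the lowest bit of \<^term>\<open>t\<close>, so that at most \<^term>\<open>k\<close> blocks
  cover a prefix whose length has only its top \<^term>\<open>k\<close> bits set.\<close>

lemma rank_le_of_blocks_eq:
  assumes eq: "\<And>t. t \<le> T \<Longrightarrow> reports_at q t \<Longrightarrow>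
      block_summary p (take t xs) = block_summary p (take t ys)"
    and "T \<le> length xs" "T \<le> length ys" "T < 2 ^ Suc r"
    and "2 ^ (Suc r - k) dvd T" "k \<le> Suc q" "k \<le> Suc r"
  shows "rank (mset (take T ys)) x \<le> rank (mset (take T xs)) x + k * (2 ^ (r - p) - 1)"
  using assms
proof (induction k arbitrary: T)
  case 0
  then have "T = 0" by (auto dest: dvd_imp_le)
  then show ?case by simp
next
  case (Suc k)
  define l where "l = r - k"
  have l: "Suc r - k = Suc l" "Suc r - Suc k = l" using Suc.prems(7) by (simp_all add: l_def)
  show ?case
  proof (cases "2 ^ Suc l dvd T")
    case True
    then have "rank (mset (take T ys)) x \<le> rank (mset (take T xs)) x + k * (2 ^ (r - p) - 1)"
      using Suc.prems by (intro Suc.IH) (auto simp: l)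
    then show ?thesis by simp
  next
    case False
    have dvd: "2 ^ l dvd T" using Suc.prems(5) unfolding l(2) .
    note odd = odd_multiple[OF dvd False]
    have block: "block T = 2 ^ l" using multiplicity_eqI[OF dvd False] by (simp add: block_def)
    have T: "T > 0" using False by (cases T) auto
    have "(2::nat) ^ floor_log T < 2 ^ Suc r"
      using floor_log_exp2_le[OF T] Suc.prems(4) by (rule le_less_trans)
    then have "floor_log T \<le> r"
      using power_less_imp_less_exp[of "2::nat" "floor_log T" "Suc r"] by (simp del: power_Suc)
    then have fl: "floor_log T - q \<le> l" "floor_log T - p \<le> r - p"
      using Suc.prems(6) by (auto simp: l_def)
    then have "reports_at q T" using T dvd power_le_dvd by (auto simp: reports_at_def)
    then have "block_summary p (take T xs) = block_summary p (take T ys)"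
      using Suc.prems(1) by blast
    then have sum: "summary (spacing p T) (drop (T - 2 ^ l) (take T xs)) =
        summary (spacing p T) (drop (T - 2 ^ l) (take T ys))"
      using Suc.prems(2,3) by (simp add: block_summary_def block)
    have split: "rank (mset (take T zs)) x =
        rank (mset (take (T - 2 ^ l) zs)) x + rank (mset (drop (T - 2 ^ l) (take T zs))) x" for zs
    proof -
      have "take T zs = take (T - 2 ^ l) zs @ drop (T - 2 ^ l) (take T zs)"
        by (metis append_take_drop_id diff_le_self min.absorb1 take_take)
      then show ?thesis by (metis mset_append rank_union)
    qed
    define e :: nat where "e = 2 ^ (r - p) - 1"
    \<comment> \<open>Spacing only grows with time, so blocks reported earlier are at least as
      precise as those at the level \<open>r\<close>.\<close>
    have "spacing p T - 1 \<le> e"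
      using fl(2) by (simp add: spacing_def e_def diff_le_mono power_increasing)
    moreover have "rank (mset (drop (T - 2 ^ l) (take T ys))) x
        \<le> rank (mset (drop (T - 2 ^ l) (take T xs))) x + (spacing p T - 1)"
      using sum Suc.prems(2,3) by (intro rank_le_of_summary_eq) (auto simp: spacing_def)
    ultimately have "rank (mset (drop (T - 2 ^ l) (take T ys))) x
        \<le> rank (mset (drop (T - 2 ^ l) (take T xs))) x + e"
      by (meson add_left_mono order_trans)
    moreover have "rank (mset (take (T - 2 ^ l) ys)) x
        \<le> rank (mset (take (T - 2 ^ l) xs)) x + k * e"
      unfolding e_def using Suc.prems odd by (intro Suc.IH) (auto simp: l simp del: power_Suc)
    ultimately show ?thesis unfolding split[of ys] split[of xs] e_def[symmetric] by simp
  qed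
qed

text \<open>Let \<open>T\<close> be the last reporting time in \<open>xs\<close>. Equal messages
  force \<open>ys\<close> to end between \<open>T\<close> and the next reporting time
  \<open>T + s\<close>. Up to \<open>T\<close> the blocks agree in their summaries; the tails are
  shorter than \<open>s\<close>, so their ranks differ by at most \<open>s - 1\<close>.\<close>

lemma rank_diff_le_of_sent_eq:
  assumes eq: "sent (report q p b) xs = sent (report q p b) ys"
    and bits: "set xs \<subseteq> {..<2 ^ b}" "set ys \<subseteq> {..<2 ^ b}"
  shows "\<bar>real (rank (mset ys) x) - real (rank (mset xs) x)\<bar>
    \<le> (real (Suc q) / 2 ^ p + 1 / 2 ^ q) * real (length xs)"
proof (cases "xs = []")
  case True
  \<comment> \<open>The first item is always reported, so an empty site is told apart from all
    others.\<close>
  have "reports_at q 1" by (simp add: reports_at_def)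
  then have "ys = []"
    using sent_report_eqD(1)[OF assms, of 1] True by (cases ys) auto
  then show ?thesis using True by simp
next
  case False
  define n where "n = length xs"
  define r where "r = floor_log n"
  define s :: nat where "s = 2 ^ (r - q)"
  define T where "T = n - n mod s"
  have n: "n > 0" "2 ^ r \<le> n" "n < 2 ^ Suc r"
    using False floor_log_exp2_le floor_log_exp2_gt by (auto simp: n_def r_def)
  have s: "s > 0" by (simp add: s_def)
  have s_dvd: "s dvd 2 ^ r" by (simp add: s_def le_imp_power_dvd)
  have s_T: "s dvd T" by (simp add: T_def dvd_minus_mod)
  have "T + n mod s = n" unfolding T_def by (rule le_add_diff_inverse2) (rule mod_less_eq_dividend)
  then have T: "T \<le> n" "n < T + s"
    using mod_less_divisor[OF s, of n] by (metis le_add1, metis add_less_cancel_left)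
  obtain d where "2 ^ r = s * d" using s_dvd by auto
  then have "d \<le> n div s"
    using n(2) s by (simp add: less_eq_div_iff_mult_less_eq mult.commute)
  then have "2 ^ r \<le> T"
    unfolding T_def minus_mod_eq_mult_div \<open>2 ^ r = s * d\<close> by (rule mult_le_mono2)
  then have fl_T: "floor_log T = r"
    using T(1) n(3) floor_log_eqI[of T r] less_le_trans[of 0 "2 ^ r" T] by simp
  then have rep_T: "reports_at q T"
    using s_T \<open>2 ^ r \<le> T\<close> by (auto simp: reports_at_def s_def intro: less_le_trans[of 0 "2 ^ r"])
  \<comment> \<open>The delicate case is \<open>T + s = 2 ^ Suc r\<close>, where the required
    divisor may double; a power of two this large is still divisible by it.\<close>
  have next_rep: "reports_at q (T + s)"
  proof -
    have "T + s \<le> 2 ^ Suc r"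
    proof -
      have "s dvd 2 ^ Suc r" using s_dvd by (rule dvd_trans) simp
      then obtain e where e: "2 ^ Suc r = s * e" by auto
      obtain c where c: "T = s * c" using s_T by auto
      have "s * c < s * e" using T(1) n(3) c e by linarith
      then have "s * Suc c \<le> s * e" using s by (simp del: mult_Suc_right)
      then show ?thesis using c e by simp
    qed
    then have "floor_log (T + s) \<le> Suc r"
      using floor_log_le_iff[of "T + s" "2 ^ Suc r"] by simp
    moreover have "2 ^ (Suc r - q) dvd T + s" if "floor_log (T + s) = Suc r"
    proof -
      have "2 ^ Suc r \<le> T + s" using floor_log_exp2_le[of "T + s"] that s by simp
      then have "T + s = 2 ^ Suc r" using \<open>T + s \<le> 2 ^ Suc r\<close> by simp
      then show ?thesis by (simp add: le_imp_power_dvd del: power_Suc)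
    qed
    moreover have "2 ^ (floor_log (T + s) - q) dvd s" if "floor_log (T + s) \<le> r"
      using that by (simp add: s_def le_imp_power_dvd)
    ultimately show ?thesis
      using s s_T by (cases "floor_log (T + s) = Suc r") (auto simp: reports_at_def intro: dvd_add dvd_trans)
  qed
  have "T \<le> length ys"
    using sent_report_eqD(1)[OF assms, of T] rep_T T(1) unfolding n_def by blast
  moreover have "\<not> T + s \<le> length ys"
    using sent_report_eqD(1)[OF assms, of "T + s"] next_rep T(2) unfolding n_def by (meson not_le)
  ultimately have Ty: "T \<le> length ys" "length ys < T + s" by simp_all
  have blocks: "block_summary p (take t xs) = block_summary p (take t ys)"
    if "t \<le> T" "reports_at q t" for t
    using sent_report_eqD(2)[OF assms] that T by (simp add: n_def)
  \<comment> \<open>Only the top \<open>Suc q\<close> bits of \<open>T\<close> can be set, and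
    \<open>T\<close> has just \<open>Suc r\<close> bits.\<close>
  let ?k = "min (Suc q) (Suc r)"
  have dvd: "2 ^ (Suc r - ?k) dvd T" using s_T by (cases "q \<le> r") (auto simp: s_def min_def)
  have lt: "T < 2 ^ Suc r" using T n by linarith
  define e where "e = Suc q * (2 ^ (r - p) - 1)"
  have k: "?k * (2 ^ (r - p) - 1) \<le> e" unfolding e_def by (rule mult_right_mono) auto
  have Tx: "T \<le> length xs" using T(1) by (simp add: n_def)
  have "rank (mset (take T ys)) x \<le> rank (mset (take T xs)) x + ?k * (2 ^ (r - p) - 1)"
    by (rule rank_le_of_blocks_eq[OF blocks Tx Ty(1) lt dvd]) auto
  moreover have "rank (mset (take T xs)) x \<le> rank (mset (take T ys)) x + ?k * (2 ^ (r - p) - 1)"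
    by (rule rank_le_of_blocks_eq[OF blocks[symmetric] Ty(1) Tx lt dvd]) auto
  ultimately have pre: "rank (mset (take T ys)) x \<le> rank (mset (take T xs)) x + e"
    "rank (mset (take T xs)) x \<le> rank (mset (take T ys)) x + e"
    using k by (meson add_left_mono order_trans)+
  have split: "rank (mset zs) x = rank (mset (take T zs)) x + rank (mset (drop T zs)) x" for zs
    by (metis append_take_drop_id mset_append rank_union)
  have post: "rank (mset (drop T xs)) x \<le> s - 1" "rank (mset (drop T ys)) x \<le> s - 1"
    using rank_le_size[of "mset (drop T xs)" x] rank_le_size[of "mset (drop T ys)" x] T Ty
    by (auto simp: n_def)
  \<comment> \<open>Subtracting 1 matters for \<open>i > r\<close>: the truncated exponent is 0 and
    the left side vanishes.\<close>
  have pow: "real (2 ^ (r - i) - 1) \<le> real n / 2 ^ i" for i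
  proof (cases "i \<le> r")
    case True
    have "real (2 ^ (r - i) - 1) \<le> 2 ^ (r - i)" by simp
    also have "\<dots> = 2 ^ r / 2 ^ i" using True by (simp add: power_diff)
    also have "\<dots> \<le> real n / 2 ^ i"
      using n(2) by (intro divide_right_mono) (auto simp: numeral_power_le_of_nat_cancel_iff)
    finally show ?thesis .
  qed simp
  have "\<bar>real (rank (mset ys) x) - real (rank (mset xs) x)\<bar> \<le> real (e + (s - 1))"
    using pre post unfolding split[of ys] split[of xs] by linarith
  also have "\<dots> \<le> real (Suc q) * (real n / 2 ^ p) + real n / 2 ^ q"
    unfolding of_nat_add e_def of_nat_mult s_def by (intro add_mono mult_left_mono pow) auto
  also have "\<dots> = (real (Suc q) / 2 ^ p + 1 / 2 ^ q) * real (length xs)"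
    by (simp add: n_def algebra_simps add_divide_distrib)
  finally show ?thesis .
qed

section \<open>Communication cost\<close>

lemma words_le: "real (words w m) \<le> 1 + real (length m) / real w"
proof -
  have "0 \<le> real (length m) / real w" by simp
  then show ?thesis unfolding words_def by linarith
qed

lemma card_multiples_between_powers:
  assumes "l \<le> r"
  shows "card {t \<in> {2 ^ r..<2 ^ Suc r}. 2 ^ l dvd (t::nat)} \<le> 2 ^ (r - l)"
proof -
  have r: "(2::nat) ^ r = 2 ^ l * 2 ^ (r - l)"
    using assms by (simp flip: power_add)
  have "{t \<in> {2 ^ r..<2 ^ Suc r}. 2 ^ l dvd (t::nat)} \<subseteq> (*) (2 ^ l) ` {2 ^ (r - l)..<2 * 2 ^ (r - l)}"
  proof
    fix t :: nat
    assume "t \<in> {t \<in> {2 ^ r..<2 ^ Suc r}. 2 ^ l dvd t}"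
    then obtain m where m: "t = 2 ^ l * m" "2 ^ r \<le> t" "t < 2 * 2 ^ r" by auto
    have "2 ^ l * 2 ^ (r - l) \<le> 2 ^ l * m" "2 ^ l * m < 2 ^ l * (2 * 2 ^ (r - l))"
      using m unfolding r by simp_all
    then have "2 ^ (r - l) \<le> m" "m < 2 * 2 ^ (r - l)"
      unfolding nat_mult_le_cancel1[OF zero_less_power[OF pos2]] nat_mult_less_cancel1[OF zero_less_power[OF pos2]]
      by simp_all
    then show "t \<in> (*) (2 ^ l) ` {2 ^ (r - l)..<2 * 2 ^ (r - l)}" using m(1) by auto
  qed
  then have "card {t \<in> {2 ^ r..<2 ^ Suc r}. 2 ^ l dvd (t::nat)} \<le> card ((*) (2 ^ l) ` {2 ^ (r - l)..<2 * 2 ^ (r - l) :: nat})"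
    by (intro card_mono) auto
  also have "\<dots> \<le> card {2 ^ (r - l)..<2 * 2 ^ (r - l) :: nat}" by (rule card_image_le) simp
  finally show ?thesis by simp
qed

text \<open>At most \<open>2 ^ (r - l)\<close> times in the range are multiples of
  \<open>2 ^ l\<close>, and a block of that size sends at most \<open>2 ^ l / 2 ^ (r - p)\<close>
  items. So each level contributes at most \<open>2 ^ p\<close>, and there are at most
  \<open>Suc q\<close> levels.\<close>

lemma sum_blocks_le:
  "(\<Sum>t | t \<in> {2 ^ r..<2 ^ Suc r} \<and> 2 ^ (r - q) dvd t. real (block t div spacing p t))
     \<le> real (Suc q) * 2 ^ p"
proof -
  define S where "S = {t::nat. t \<in> {2 ^ r..<2 ^ Suc r} \<and> 2 ^ (r - q) dvd t}"
  define I where "I = {r - q..r}"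
  have S: "finite S" by (simp add: S_def)
  \<comment> \<open>Charging \<open>t\<close> to every level that divides it, not just its exact
    one, overestimates but makes the sums easy to swap.\<close>
  have t: "real (block t div spacing p t) \<le> (\<Sum>l\<in>I. if 2 ^ l dvd t then 2 ^ l / 2 ^ (r - p) else 0)"
    if "t \<in> S" for t
  proof -
    define l where "l = multiplicity 2 t"
    have t0: "t > 0" using that by (auto simp: S_def intro: less_le_trans[of 0 "2 ^ r"])
    have "t < 2 ^ Suc r" using that by (simp add: S_def)
    have "2 ^ l \<le> t" using t0 by (simp add: l_def multiplicity_dvd dvd_imp_le)
    then have "(2::nat) ^ l < 2 ^ Suc r" using \<open>t < 2 ^ Suc r\<close> by linarith
    then have "l \<le> r" using power_less_imp_less_exp[of "2::nat" l "Suc r"] by (simp del: power_Suc)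
    moreover have "r - q \<le> l"
      using that t0 unfolding S_def l_def by (intro multiplicity_geI) auto
    ultimately have l: "l \<in> I" by (simp add: I_def)
    have "floor_log t = r" using that t0 by (intro floor_log_eqI) (auto simp: S_def)
    then have "real (block t div spacing p t) \<le> 2 ^ l / 2 ^ (r - p)"
      using of_nat_div_le_of_nat[where ?'a = real, of "2 ^ l" "2 ^ (r - p)"] by (simp add: block_def l_def spacing_def)
    also have "\<dots> = (\<Sum>l'\<in>{l}. if 2 ^ l' dvd t then 2 ^ l' / 2 ^ (r - p) else 0)"
      by (simp add: l_def multiplicity_dvd)
    also have "\<dots> \<le> (\<Sum>l\<in>I. if 2 ^ l dvd t then 2 ^ l / 2 ^ (r - p) else 0)"
      using l by (intro sum_mono2) (auto simp: I_def)
    finally show ?thesis .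
  qed
  have level: "(\<Sum>t\<in>S. if 2 ^ l dvd t then 2 ^ l / 2 ^ (r - p) else 0) \<le> (2 ^ p :: real)" if "l \<in> I" for l
  proof -
    have l: "l \<le> r" using that by (simp add: I_def)
    have "card {t \<in> S. 2 ^ l dvd t} \<le> card {t \<in> {2 ^ r..<2 ^ Suc r}. 2 ^ l dvd (t::nat)}"
      by (intro card_mono) (auto simp: S_def)
    also have "\<dots> \<le> 2 ^ (r - l)" by (rule card_multiples_between_powers[OF l])
    finally have c: "real (card {t \<in> S. 2 ^ l dvd t}) \<le> 2 ^ (r - l)"
      by (simp add: numeral_power_le_of_nat_cancel_iff of_nat_le_numeral_power_cancel_iff)
    have "(\<Sum>t\<in>S. if 2 ^ l dvd t then 2 ^ l / 2 ^ (r - p) else 0) =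
        real (card {t \<in> S. 2 ^ l dvd t}) * (2 ^ l / 2 ^ (r - p))"
      using S by (simp add: sum.If_cases Int_def)
    also have "\<dots> \<le> 2 ^ (r - l) * (2 ^ l / 2 ^ (r - p))"
      using c by (intro mult_right_mono) auto
    also have "\<dots> = 2 ^ r / 2 ^ (r - p)" using l by (simp flip: power_add)
    also have "\<dots> \<le> 2 ^ p"
    proof -
      have "(2::real) ^ r \<le> 2 ^ (p + (r - p))" by (intro power_increasing) auto
      then show ?thesis by (simp add: divide_le_eq power_add)
    qed
    finally show ?thesis .
  qed
  have "(\<Sum>t\<in>S. real (block t div spacing p t))
      \<le> (\<Sum>t\<in>S. \<Sum>l\<in>I. if 2 ^ l dvd t then 2 ^ l / 2 ^ (r - p) else 0)"
    by (rule sum_mono[OF t])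
  also have "\<dots> = (\<Sum>l\<in>I. \<Sum>t\<in>S. if 2 ^ l dvd t then 2 ^ l / 2 ^ (r - p) else 0)"
    by (rule sum.swap)
  also have "\<dots> \<le> (\<Sum>l\<in>I. 2 ^ p)" by (rule sum_mono[OF level])
  also have "\<dots> \<le> real (Suc q) * 2 ^ p" by (simp add: I_def)
  finally show ?thesis by (simp add: S_def)
qed

text \<open>Reports are grouped by \<open>floor_log\<close>. Each doubling has at most
  \<open>2 ^ q\<close> of them, each costing one word for rounding up; \<open>sum_blocks_le\<close>
  bounds the items they carry.\<close>

lemma sent_report_words_le:
  assumes "xs \<noteq> []"
  shows "real (\<Sum>m\<leftarrow>sent (report q p b) xs. words w m)
    \<le> real (Suc (floor_log (length xs))) * (2 ^ q + real b / real w * (real (Suc q) * 2 ^ p))"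
proof -
  define n where "n = length xs"
  define \<beta> where "\<beta> = real b / real w"
  define h where "h = (\<lambda>t. 1 + \<beta> * real (block t div spacing p t))"
  define T where "T = {t. t \<le> n \<and> reports_at q t}"
  have \<beta>: "\<beta> \<ge> 0" by (simp add: \<beta>_def)
  have h0: "h t \<ge> 0" for t using \<beta> by (simp add: h_def)
  have words: "real (words w (concat (map (encode b) (block_summary p (take t xs))))) \<le> h t"
    if "t \<in> set (filter (reports_at q) [1..<Suc (length xs)])" for t
  proof -
    have t: "t > 0" "t \<le> length xs" using that by auto
    have "block t \<le> t" using t(1) block_dvd by (simp add: dvd_imp_le)
    then have "length (block_summary p (take t xs)) = block t div spacing p t"
      using t by (simp add: block_summary_def summary_def min_def)
    moreover have "length (concat (map (encode b) zs)) = b * length zs" for zs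
      by (induction zs) (simp_all add: encode_def)
    ultimately show ?thesis
      using words_le[of w "concat (map (encode b) (block_summary p (take t xs)))"]
      by (simp add: h_def \<beta>_def)
  qed
  have T: "finite T" "set (filter (reports_at q) [1..<Suc (length xs)]) = T"
    by (auto simp: T_def n_def reports_at_def)
  have "real (\<Sum>m\<leftarrow>sent (report q p b) xs. words w m)
      = (\<Sum>t\<leftarrow>filter (reports_at q) [1..<Suc (length xs)].
          real (words w (concat (map (encode b) (block_summary p (take t xs))))))"
    unfolding sent_report sum_list_of_nat[symmetric] map_map o_def ..
  also have "\<dots> \<le> (\<Sum>t\<leftarrow>filter (reports_at q) [1..<Suc (length xs)]. h t)"
    by (rule sum_list_mono[OF words])
  also have "\<dots> = sum h T"
    unfolding T(2)[symmetric] by (rule sum_list_distinct_conv_sum_set) simp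
  also have "\<dots> = (\<Sum>r\<le>floor_log n. \<Sum>t | t \<in> T \<and> floor_log t = r. h t)"
    using T(1) by (intro sum.group[symmetric]) (auto simp: T_def floor_log_le_iff)
  also have "\<dots> \<le> (\<Sum>r\<le>floor_log n. 2 ^ q + \<beta> * (real (Suc q) * 2 ^ p))"
  proof (rule sum_mono)
    fix r
    let ?S = "{t::nat. t \<in> {2 ^ r..<2 ^ Suc r} \<and> 2 ^ (r - q) dvd t}"
    have "{t. t \<in> T \<and> floor_log t = r} \<subseteq> ?S"
      using floor_log_exp2_le floor_log_exp2_gt by (auto simp: T_def reports_at_def)
    then have "(\<Sum>t | t \<in> T \<and> floor_log t = r. h t) \<le> sum h ?S"
      using h0 by (intro sum_mono2) auto
    also have "\<dots> = real (card ?S) + \<beta> * (\<Sum>t\<in>?S. real (block t div spacing p t))"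
      by (simp add: h_def sum.distrib sum_distrib_left)
    also have "\<dots> \<le> 2 ^ q + \<beta> * (real (Suc q) * 2 ^ p)"
    proof (intro add_mono mult_left_mono sum_blocks_le \<beta>)
      have "card ?S \<le> 2 ^ (r - (r - q))"
        using card_multiples_between_powers[of "r - q" r] by simp
      also have "\<dots> \<le> 2 ^ q" by (intro power_increasing) auto
      finally show "real (card ?S) \<le> 2 ^ q" by (simp add: of_nat_le_numeral_power_cancel_iff)
    qed
    finally show "(\<Sum>t | t \<in> T \<and> floor_log t = r. h t) \<le> 2 ^ q + \<beta> * (real (Suc q) * 2 ^ p)" .
  qed
  finally show ?thesis by (simp add: n_def \<beta>_def)
qed

section \<open>Choice of parameters and total cost\<close>

lemma power_of_two_above:
  assumes "x \<ge> (1::real)"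
  obtains q where "x \<le> 2 ^ q" "2 ^ q \<le> 2 * x" "real q \<le> log 2 x + 1"
proof
  let ?q = "nat \<lceil>log 2 x\<rceil>"
  have l: "0 \<le> log 2 x" using assms by simp
  then show le: "real ?q \<le> log 2 x + 1" by linarith
  have "log 2 x \<le> real ?q" by linarith
  then have "2 powr log 2 x \<le> 2 powr real ?q" by (rule powr_mono) simp
  also have "2 powr real ?q = 2 ^ ?q" by (rule powr_realpow) simp
  finally show "x \<le> 2 ^ ?q" using assms by simp
  have "2 ^ ?q = 2 powr real ?q" by (rule powr_realpow[symmetric]) simp
  also have "\<dots> \<le> 2 powr (log 2 x + 1)" using le by (rule powr_mono) simp
  also have "\<dots> = 2 * x" using assms by (simp add: powr_add)
  finally show "2 ^ ?q \<le> 2 * x" .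
qed

lemma reporting_protocol_cost_le:
  assumes "2 \<le> n" "w > 0" and A: "is_stream k u A" "length A = n" "reaches (decoding_protocol k u (report q p b)) A c"
  shows "real (cost w c) \<le> real k * (2 * log 2 (real n) * (2 ^ q + real b / real w * (real (Suc q) * 2 ^ p)))"
proof -
  define K where "K = 2 ^ q + real b / real w * (real (Suc q) * 2 ^ p)"
  have K: "0 \<le> K" by (simp add: K_def)
  have L: "1 \<le> log 2 (real n)" using assms(1) by (simp add: le_log_iff)
  have site: "real (\<Sum>m\<leftarrow>sent (report q p b) (items_at i A). words w m) \<le> 2 * log 2 (real n) * K" for i
  proof (cases "items_at i A = []")
    case True
    then show ?thesis using K L by simp
  next
    case False
    have "length (items_at i A) \<le> n" by (simp add: items_at_def A(2)[symmetric])
    then have "floor_log (length (items_at i A)) \<le> floor_log n" by (rule floor_log_le_iff)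
    also have "real \<dots> \<le> log 2 (real n)" using assms(1) L by (simp add: floor_log_altdef)
    finally have "real (Suc (floor_log (length (items_at i A)))) \<le> 2 * log 2 (real n)" using L by simp
    with sent_report_words_le[OF False, where q = q and p = p and b = b and w = w] show ?thesis
      unfolding K_def[symmetric] by (rule order_trans[OF _ mult_right_mono[OF _ K]])
  qed
  have "real (cost w c) = (\<Sum>i=1..k. real (\<Sum>m\<leftarrow>sent (report q p b) (items_at i A). words w m))"
    using A by (simp add: cost_one_way decoding_protocol_def)
  also have "\<dots> \<le> (\<Sum>i=1..k. 2 * log 2 (real n) * K)" by (rule sum_mono[OF site])
  finally show ?thesis by (simp add: K_def)
qed

theorem theorem5:
  fixes c\<^sub>1 c\<^sub>2 d :: real
  assumes "0 < c\<^sub>1" and "c\<^sub>1 \<le> c\<^sub>2" and "0 < d"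
  shows "\<exists>C>0. \<forall>k\<ge>2. \<forall>\<epsilon>>0. \<exists>n\<^sub>0. \<forall>u\<ge>1. \<exists>P.
           addresses_sites k P \<and>
           tracks_all_quantiles k u \<epsilon> P \<and>
           (\<forall>n\<ge>n\<^sub>0. \<forall>w::nat.
              c\<^sub>1 * log 2 (real n) \<le> real w \<and> real w \<le> c\<^sub>2 * log 2 (real n) \<and>
              real u \<le> real n powr d \<longrightarrow>
              (\<forall>A c. is_stream k u A \<and> length A = n \<and> reaches P A c \<longrightarrow>
                 real (cost w c) \<le>
                   C * (real k / \<epsilon>) * log 2 (real n) * (max 1 (log 2 (1 / \<epsilon>)))\<^sup>2))"
proof -
  \<comment> \<open>Below, \<open>2 ^ q\<close> is at most 8 times and \<open>Suc q * 2 ^ p\<close>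
    at most 400 times \<open>E\<^sup>2 / \<epsilon>\<close>, and \<open>b / w\<close> is at most
    \<open>(d + 2) / c\<^sub>1\<close>. The factor 2 of \<open>2 * log 2 n\<close> doubles both
    constants.\<close>
  define C where "C = 16 + 800 * ((d + 2) / c\<^sub>1)"
  have C_half: "8 * x + y * (400 * x) = (16 + 800 * y) / 2 * x" for x y :: real
    by (simp add: algebra_simps)
  have C: "C > 0" using assms by (simp add: C_def add_pos_nonneg)
  \<comment> \<open>The threshold \<open>n\<^sub>0 = 2\<close> serves all \<open>k\<close>,
    \<open>\<epsilon>\<close> and \<open>u\<close>; it ensures
    \<open>log 2 n \<ge> 1\<close>.\<close>
  have "\<exists>P. addresses_sites k P \<and> tracks_all_quantiles k u \<epsilon> P \<and>
           (\<forall>n\<ge>2. \<forall>w::nat.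
              c\<^sub>1 * log 2 (real n) \<le> real w \<and> real w \<le> c\<^sub>2 * log 2 (real n) \<and>
              real u \<le> real n powr d \<longrightarrow>
              (\<forall>A c. is_stream k u A \<and> length A = n \<and> reaches P A c \<longrightarrow>
                 real (cost w c) \<le>
                   C * (real k / \<epsilon>) * log 2 (real n) * (max 1 (log 2 (1 / \<epsilon>)))\<^sup>2))"
    if e: "\<epsilon> > 0" and u: "u \<ge> 1" for k u :: nat and \<epsilon> :: real
  proof (cases "\<epsilon> \<ge> 1")
    case True
    let ?P = "one_way (\<lambda>_. None) (\<lambda>_ _. 1) (\<lambda>_ _. 0)"
    have "cost w c = 0" if "is_stream k u A" "reaches ?P A c" for w A c
      unfolding cost_one_way[OF that] by (simp add: sent_def List.map_filter_def)
    moreover have "addresses_sites k ?P" by (simp add: addresses_sites_def one_way_def)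
    moreover have "0 \<le> C * (real k / \<epsilon>) * log 2 (real n) * (max 1 (log 2 (1 / \<epsilon>)))\<^sup>2"
      if "n \<ge> 2" for n
      using that C e by (intro mult_nonneg_nonneg) auto
    ultimately show ?thesis
      using tracks_silent[OF u True] by (intro exI[of _ ?P] conjI allI impI) auto
  next
    case False
    define E where "E = max 1 (log 2 (1 / \<epsilon>))"
    have E: "1 \<le> E" "log 2 (1 / \<epsilon>) \<le> E" by (simp_all add: E_def)
    \<comment> \<open>The error budget \<open>\<epsilon> / 2\<close> is halved:
      \<open>1 / 2 ^ q\<close> covers the unreported items, and \<open>j\<close> below makes
      \<open>Suc q / 2 ^ p\<close> no larger.\<close>
    obtain q where q: "4 / \<epsilon> \<le> 2 ^ q" "2 ^ q \<le> 2 * (4 / \<epsilon>)" "real q \<le> log 2 (4 / \<epsilon>) + 1"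
      using e False by (auto intro: power_of_two_above[of "4 / \<epsilon>"])
    have "log 2 (4::real) = 2" using log_pow_cancel[of 2 2] by simp
    then have "log 2 (4 / \<epsilon>) = 2 + log 2 (1 / \<epsilon>)" using e by (simp add: log_divide)
    then have qE: "real (Suc q) \<le> 5 * E" using q(3) E by simp
    obtain j where j: "real (Suc q) \<le> 2 ^ j" "2 ^ j \<le> 2 * real (Suc q)"
      using power_of_two_above[of "real (Suc q)"] by auto
    define p where "p = q + j"
    obtain b where b: "real u + 1 \<le> 2 ^ b" "real b \<le> log 2 (real u + 1) + 1"
      using power_of_two_above[of "real u + 1"] by auto
    let ?P = "decoding_protocol k u (report q p b)"
    have error: "real (Suc q) / 2 ^ p + 1 / 2 ^ q \<le> \<epsilon> / 2"
    proof -
      have "real (Suc q) / 2 ^ p + 1 / 2 ^ q = (real (Suc q) / 2 ^ j + 1) / 2 ^ q"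
        by (simp add: p_def power_add field_simps)
      also have "\<dots> \<le> (1 + 1) / 2 ^ q"
        using j(1) by (intro divide_right_mono add_right_mono) (auto simp: divide_le_eq)
      also have "\<dots> \<le> \<epsilon> / 2" using q(1) e by (simp add: field_simps)
      finally show ?thesis .
    qed
    have "tracks_all_quantiles k u \<epsilon> ?P"
    proof (rule tracks_decoding_protocol[OF u e])
      fix xs ys x
      assume *: "set xs \<subseteq> {1..u}" "set ys \<subseteq> {1..u}" "sent (report q p b) xs = sent (report q p b) ys"
      have "real (u + 1) \<le> real (2 ^ b)" using b(1) by simp
      then have "u < 2 ^ b" unfolding of_nat_le_iff by simp
      then have "{1..u} \<subseteq> {..<2 ^ b}" by auto
      then have "\<bar>real (rank (mset ys) x) - real (rank (mset xs) x)\<bar>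
          \<le> (real (Suc q) / 2 ^ p + 1 / 2 ^ q) * real (length xs)"
        using * by (intro rank_diff_le_of_sent_eq[of q p b]) auto
      also have "\<dots> \<le> \<epsilon> / 2 * real (length xs)" using error by (intro mult_right_mono) auto
      finally show "\<bar>real (rank (mset ys) x) - real (rank (mset xs) x)\<bar> \<le> \<epsilon> / 2 * real (length xs)" .
    qed
    moreover have "addresses_sites k ?P"
      by (simp add: addresses_sites_def decoding_protocol_def one_way_def)
    moreover have "real (cost w c) \<le> C * (real k / \<epsilon>) * log 2 (real n) * E\<^sup>2"
      if n: "n \<ge> 2" and w: "c\<^sub>1 * log 2 (real n) \<le> real w" and un: "real u \<le> real n powr d"
        and A: "is_stream k u A" "length A = n" "reaches ?P A c" for n w A c
    proof -
      define L where "L = log 2 (real n)"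
      have L: "1 \<le> L" using n by (simp add: L_def le_log_iff)
      have "0 < c\<^sub>1 * L" using assms(1) L by simp
      then have w0: "real w > 0" using w unfolding L_def by linarith
      \<comment> \<open>Since \<open>u + 1 \<le> 2 * u\<close>, the width \<open>b\<close> is of
        order \<open>log 2 n\<close>, so that an item occupies a bounded number of words.\<close>
      have "log 2 (real u + 1) \<le> log 2 (2 * real n powr d)"
        using un u n by (subst log_le_cancel_iff) auto
      also have "\<dots> = 1 + d * L" using n by (simp add: log_mult log_powr L_def)
      finally have "real b \<le> d * L + 2" using b(2) by simp
      also have "\<dots> \<le> (d + 2) * L" using L by (simp add: algebra_simps)
      finally have "real b / real w \<le> (d + 2) * L / (c\<^sub>1 * L)"
        using w \<open>0 < c\<^sub>1 * L\<close> assms L unfolding L_def[symmetric] by (intro frac_le) auto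
      then have bw: "real b / real w \<le> (d + 2) / c\<^sub>1" using L by simp
      have "real (Suc q) * 2 ^ p = real (Suc q) * (2 ^ q * 2 ^ j)" by (simp add: p_def power_add)
      also have "\<dots> \<le> 5 * E * (2 * (4 / \<epsilon>) * (2 * (5 * E)))"
        using qE q(2) j(2) E e by (intro mult_mono) auto
      also have "\<dots> = 400 * (E\<^sup>2 / \<epsilon>)" by (simp add: power2_eq_square)
      finally have "real (Suc q) * 2 ^ p \<le> 400 * (E\<^sup>2 / \<epsilon>)" .
      then have "real b / real w * (real (Suc q) * 2 ^ p) \<le> (d + 2) / c\<^sub>1 * (400 * (E\<^sup>2 / \<epsilon>))"
        by (rule mult_mono[OF bw]) (use assms in auto)
      moreover have "1 \<le> E\<^sup>2" using E by simp
      then have "2 ^ q \<le> 8 * (E\<^sup>2 / \<epsilon>)"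
        using q(2) e by (intro order_trans[OF q(2)]) (simp add: divide_right_mono)
      ultimately have "2 ^ q + real b / real w * (real (Suc q) * 2 ^ p)
          \<le> 8 * (E\<^sup>2 / \<epsilon>) + (d + 2) / c\<^sub>1 * (400 * (E\<^sup>2 / \<epsilon>))"
        by (intro add_mono)
      also have "\<dots> = C / 2 * (E\<^sup>2 / \<epsilon>)" unfolding C_def by (rule C_half)
      finally have "2 ^ q + real b / real w * (real (Suc q) * 2 ^ p) \<le> C / 2 * (E\<^sup>2 / \<epsilon>)" .
      then have "real k * (2 * L * (2 ^ q + real b / real w * (real (Suc q) * 2 ^ p)))
          \<le> real k * (2 * L * (C / 2 * (E\<^sup>2 / \<epsilon>)))"
        using L by (intro mult_left_mono) auto
      also have "\<dots> = C * (real k / \<epsilon>) * L * E\<^sup>2" by simp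
      finally show ?thesis
        using order_trans[OF reporting_protocol_cost_le[OF n _ A, of w]] w0 unfolding L_def[symmetric] by simp
    qed
    ultimately show ?thesis unfolding E_def by (intro exI[of _ ?P]) blast
  qed
  then show ?thesis using C by (intro exI[of _ C]) blast
qed

end
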